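(* Let $K$ be a field, $V$ a vector space over $K$, $A:V\to V$ a linear operator, $b_1,\dots,b_n\in K$ and $\varphi_1,\dots,\varphi_n\in V$. The system of linear operator equations in the unknowns $x_1,\dots,x_n\in V$ $$A(x_j)=b_jx_1+b_jx_2+\dots+b_jx_n+\varphi_j,\qquad 1\le j\le n,$$ can be transformed into the system $$A(z_j)=\nu_j\qquad(1\le j\le n-2),$$ $$\Big(A^2-\sum_{i=1}^n b_i\,A\Big)(z_{n-1})=\nu_n+A(\nu_{n-1})-\sum_{i=1}^n b_i\,\nu_{n-1},$$ $$A(z_n)-\sum_{i=1}^n b_i\,z_n=\nu_n,$$ where the columns $\vec z=[z_1\ \dots\ z_n]^T$ and $\vec\nu=[\nu_1\ \dots\ \nu_n]^T$ are determined by $\vec z=T^{-1}\vec x$ and $\vec\nu=T^{-1}\vec\varphi$, for a nonsingular matrix $T$ such that $C=T^{-1}\hat B T$.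
   Context: $\hat B\in K^{n\times n}$ is the system matrix, whose $(j,k)$ entry is $b_j$ for all $1\le j,k\le n$ (all entries of row $j$ equal $b_j$), so the original system reads $\vec A(\vec x)=\hat B\vec x+\vec\varphi$ with $\vec A$ acting componentwise by $A$. $C\in K^{n\times n}$ denotes the rational canonical form of $\hat B$, given as the matrix whose $(n-1,n)$ entry is $1$, whose $(n,n)$ entry is $\sum_{i=1}^n b_i$, and whose other entries are all $0$ (this covers both the case $\sum_{i=1}^n b_i\neq 0$ and the case $\sum_{i=1}^n b_i=0$). Here $\vec x=[x_1\ \dots\ x_n]^T$ and $\vec\varphi=[\varphi_1\ \dots\ \varphi_n]^T$ are columns in $V^{n\times 1}$, on which matrices over $K$ act by the usual matrix-times-column rule using scalar multiplication in $V$. In the equations, $\sum_{i=1}^n b_i$ is a scalar of $K$ multiplying the operator or vector that follows it.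
   Formalization: We take n ≥ 2, and existence of T is claimed only when some b_j is nonzero: if all b_j = 0 then B̂ = 0 is not similar to C, whose (n-1,n) entry is 1. "Can be transformed" means each solution x yields a solution z = T^{-1}x, for every such T. *)

theory Defs
  imports "Jordan_Normal_Form.Matrix"
begin

(* Columns in V^n are vectors of type 'v vec over the type 'v carrying the vector space,
   indexed from 0: the component x_j of the mathematical notation is x $ (j - 1). *)

definition system_mat :: "'k::field vec \<Rightarrow> 'k mat" where
  "system_mat b = mat (dim_vec b) (dim_vec b) (\<lambda>(j, k). b $ j)"

definition coeff_sum :: "'k::field vec \<Rightarrow> 'k" where
  "coeff_sum b = (\<Sum>i<dim_vec b. b $ i)"

(* Meant for dim_vec b >= 2. It is the rational canonical form of system_mat b exactly when
   system_mat b is nonzero: the zero matrix is not similar to it. *)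
definition canonical_mat :: "'k::field vec \<Rightarrow> 'k mat" where
  "canonical_mat b = mat (dim_vec b) (dim_vec b) (\<lambda>(j, k).
     if j = dim_vec b - 2 \<and> k = dim_vec b - 1 then 1
     else if j = dim_vec b - 1 \<and> k = dim_vec b - 1 then coeff_sum b
     else 0)"

(* The product of a matrix over K with a column over V. The library's *\<^sub>v requires the
   entries of both to be of the same type. *)
definition mat_act :: "('k::field \<Rightarrow> 'v::ab_group_add \<Rightarrow> 'v) \<Rightarrow> 'k mat \<Rightarrow> 'v vec \<Rightarrow> 'v vec" where
  "mat_act scale M x =
     vec (dim_row M) (\<lambda>i. \<Sum>j<dim_col M. scale (M $$ (i, j)) (x $ j))"

definition solves_system ::
  "('k::field \<Rightarrow> 'v::ab_group_add \<Rightarrow> 'v) \<Rightarrow> ('v \<Rightarrow> 'v) \<Rightarrow> 'k vec \<Rightarrow> 'v vec \<Rightarrow> 'v vec \<Rightarrow> bool" where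
  "solves_system scale A b \<phi> x \<longleftrightarrow>
     (\<forall>j<dim_vec b. A (x $ j) = (\<Sum>k<dim_vec b. scale (b $ j) (x $ k)) + \<phi> $ j)"

(* Every solution of the original system is carried to a solution of this one by a change of
   variables z = T^(-1) x, but not conversely: the coupling z_n = A(z_(n-1)) - \<nu>_(n-1) is lost
   when the first-order equation A(z_(n-1)) = z_n + \<nu>_(n-1) is replaced by a second-order one. *)
definition solves_reduced_system ::
  "('k::field \<Rightarrow> 'v::ab_group_add \<Rightarrow> 'v) \<Rightarrow> ('v \<Rightarrow> 'v) \<Rightarrow> 'k vec \<Rightarrow> 'v vec \<Rightarrow> 'v vec \<Rightarrow> bool" where
  "solves_reduced_system scale A b \<nu> z \<longleftrightarrow>
     (let n = dim_vec b; s = coeff_sum b in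
       (\<forall>j<n - 2. A (z $ j) = \<nu> $ j) \<and>
       A (A (z $ (n - 2))) - scale s (A (z $ (n - 2)))
         = \<nu> $ (n - 1) + A (\<nu> $ (n - 2)) - scale s (\<nu> $ (n - 2)) \<and>
       A (z $ (n - 1)) - scale s (z $ (n - 1)) = \<nu> $ (n - 1))"

end

theory Submission
  imports Defs "Jordan_Normal_Form.Determinant"
begin

text \<open>
  The system matrix has rank at most one: it sends a column $t$ to $(\sum_i t_i)\, b$. This governs
  both halves of the result.

  \<^item> \<^emph>\<open>Similarity.\<close> Let $s = \sum_i b_i$. In a basis $t_1, \dots, t_n$ the matrix takes the
    canonical form, if $b \neq 0$, exactly when $t_1, \dots, t_{n-1}$ have coordinate sum zero and
    $(\sum_i (t_n)_i)\, b = t_{n-1} + s\, t_n$. If $b_q \neq 0$ and $p \neq q$ is any other index,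
    then $t_n = e_p$ and $t_{n-1} = b - s\, e_p$ are independent because of their coordinates at
    $q$, and the vectors $e_r - e_p$ for $r \notin \{p, q\}$ complete them to such a basis.
    Lemma \<open>system_mat_similar_canonical_mat\<close> writes down this basis together with its dual basis.

  \<^item> \<^emph>\<open>Reduction.\<close> A linear operator commutes with the action of scalar matrices on columns, so
    $z = T^{-1} x$ turns $A(x) = \hat B x + \varphi$ into $A(z) = C z + \nu$
    (lemma \<open>mat_act_similar_system\<close>). Reading off rows gives $A(z_j) = \nu_j$ for $j \le n - 2$,
    $A(z_{n-1}) = z_n + \nu_{n-1}$ and $A(z_n) = s\, z_n + \nu_n$. Applying $A - s$ to the middle
    equation and substituting the last one eliminates $z_n$ and yields the second-order equation.
\<close>

section \<open>The canonical form of the system matrix\<close>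

lemma system_mat_carrier: "b \<in> carrier_vec n \<Longrightarrow> system_mat b \<in> carrier_mat n n"
  by (auto simp: system_mat_def)

lemma canonical_mat_carrier: "b \<in> carrier_vec n \<Longrightarrow> canonical_mat b \<in> carrier_mat n n"
  by (auto simp: canonical_mat_def)

lemma system_mat_similar_canonical_mat:
  fixes b :: "'k::field vec"
  assumes n: "n \<ge> 2" and b: "b \<in> carrier_vec n" and nz: "system_mat b \<noteq> 0\<^sub>m n n"
  shows "\<exists>T Tinv. T \<in> carrier_mat n n \<and> Tinv \<in> carrier_mat n n \<and>
           inverts_mat T Tinv \<and> inverts_mat Tinv T \<and>
           canonical_mat b = Tinv * system_mat b * T"
proof -
  have db: "dim_vec b = n" using b by simp
  define s where "s = coeff_sum b"
  have s: "s = (\<Sum>i<n. b $ i)" by (simp add: s_def coeff_sum_def db)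
  obtain q where q: "q < n" "b $ q \<noteq> 0"
  proof (rule ccontr)
    assume "\<not> thesis"
    with that have "b $ i = 0" if "i < n" for i using \<open>i < n\<close> by blast
    then have "system_mat b = 0\<^sub>m n n"
      by (intro eq_matI) (auto simp: system_mat_def db)
    with nz show False ..
  qed
  obtain p where p: "p < n" "p \<noteq> q"
  proof (cases "q = 0")
    case True with n that[of 1] show ?thesis by simp
  next
    case False with n that[of 0] show ?thesis by simp
  qed
  have "card {..<n-2} = card ({..<n} - {p, q})"
    using p q by (simp add: card_Diff_subset)
  then obtain r where r: "bij_betw r {..<n-2} ({..<n} - {p, q})"
    using finite_same_card_bij[of "{..<n-2}" "{..<n} - {p, q}"] by auto
  have r_mem: "r j < n" "r j \<noteq> p" "r j \<noteq> q" if "j < n - 2" for j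
    using bij_betwE[OF r] that by auto
  have r_inj: "r j = r k \<longleftrightarrow> j = k" if "j < n - 2" "k < n - 2" for j k
    using bij_betw_imp_inj_on[OF r] that by (auto simp: inj_on_def)
  define e where "e a i = (if i = a then 1 else 0 :: 'k)" for a i :: nat
  \<comment> \<open>Column \<open>k\<close> of the basis. The indices other than \<open>p\<close> and \<open>q\<close> are enumerated by \<open>r\<close> in
      any order, as the canonical form vanishes on the corresponding vectors.\<close>
  define t where "t i k = (if k = n - 1 then e p i
      else if k = n - 2 then b $ i - s * e p i else e (r k) i - e p i)" for i k
  \<comment> \<open>The dual basis: the sum functional, evaluation at \<open>q\<close> normalised on \<open>b\<close>, and evaluations
      at the remaining \<open>r j\<close> corrected to vanish on \<open>b\<close>.\<close>
  define w where "w j i = (if j = n - 1 then 1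
      else if j = n - 2 then e q i / b $ q
      else e (r j) i - b $ (r j) / b $ q * e q i)" for j i
  define T where "T = mat n n (\<lambda>(i, k). t i k)"
  define Tinv where "Tinv = mat n n (\<lambda>(j, i). w j i)"
  have T: "T \<in> carrier_mat n n" and Tinv: "Tinv \<in> carrier_mat n n"
    by (simp_all add: T_def Tinv_def)
  have rows: "j = n - 1 \<or> (j \<noteq> n - 1 \<and> j = n - 2) \<or> (j < n - 2 \<and> j \<noteq> n - 1 \<and> j \<noteq> n - 2)"
    if "j < n" for j
    using that by arith
  have sum_e: "(\<Sum>i<n. e a i) = 1" if "a < n" for a
    using that by (simp add: e_def)
  have pick: "(\<Sum>i<n. e a i * f i) = f a" if "a < n" for a f
  proof -
    have "(\<Sum>i<n. e a i * f i) = (\<Sum>i<n. if i = a then f i else 0)"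
      by (intro sum.cong) (auto simp: e_def)
    with that show ?thesis by simp
  qed
  have w_act: "(\<Sum>i<n. w j i * f i) = (if j = n - 1 then \<Sum>i<n. f i
      else if j = n - 2 then f q / b $ q else f (r j) - b $ (r j) / b $ q * f q)"
    if "j < n" for j f
  proof -
    consider "j = n - 1" | "j \<noteq> n - 1" "j = n - 2" | "j < n - 2" "j \<noteq> n - 1" "j \<noteq> n - 2"
      using rows[OF \<open>j < n\<close>] by blast
    then show ?thesis
    proof cases
      case 1
      then show ?thesis by (simp add: w_def)
    next
      case 2
      have "(\<Sum>i<n. w j i * f i) = (\<Sum>i<n. e q i * f i) / b $ q"
        unfolding sum_divide_distrib using 2 by (intro sum.cong) (auto simp: w_def)
      with 2 pick[OF q(1), of f] show ?thesis by simp
    next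
      case 3
      have "(\<Sum>i<n. w j i * f i)
          = (\<Sum>i<n. e (r j) i * f i) - b $ (r j) / b $ q * (\<Sum>i<n. e q i * f i)"
        unfolding sum_distrib_left sum_subtractf[symmetric] using 3
        by (intro sum.cong) (auto simp: w_def left_diff_distrib)
      with 3 pick[OF q(1), of f] pick[OF r_mem(1)[OF 3(1)], of f] show ?thesis by simp
    qed
  qed
  have ne: "n - 2 \<noteq> n - 1" using n by arith
  have t_last: "t i (n - 1) = e p i" and t_pen: "t i (n - 2) = b $ i - s * e p i" for i
    using ne by (simp_all add: t_def)
  have t_low: "t i k = e (r k) i - e p i" if "k < n - 2" for i k
    using rows[of k] that by (auto simp: t_def)
  have sum_t: "(\<Sum>i<n. t i k) = (if k = n - 1 then 1 else 0)" if "k < n" for k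
    using rows[OF that]
  proof (elim disjE conjE)
    assume k: "k = n - 1"
    show ?thesis unfolding k t_last using sum_e[OF p(1)] by simp
  next
    assume k: "k \<noteq> n - 1" "k = n - 2"
    have "(\<Sum>i<n. b $ i - s * e p i) = 0"
      unfolding sum_subtractf sum_distrib_left[symmetric] using sum_e[OF p(1)] s by simp
    with k(1) show ?thesis unfolding k(2) t_pen by simp
  next
    assume k: "k < n - 2" "k \<noteq> n - 1"
    have "(\<Sum>i<n. e (r k) i - e p i) = 0"
      unfolding sum_subtractf using sum_e[OF p(1)] sum_e[OF r_mem(1)[OF k(1)]] by simp
    with k(2) show ?thesis unfolding t_low[OF k(1)] by simp
  qed
  have t_q: "t q k = (if k = n - 2 then b $ q else 0)" if "k < n" for k
    using rows[OF that]
  proof (elim disjE conjE)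
    assume "k = n - 1"
    then show ?thesis using ne p(2) t_last[of q] by (simp add: e_def)
  next
    assume "k = n - 2"
    then show ?thesis using p(2) t_pen[of q] by (simp add: e_def)
  next
    assume "k < n - 2" "k \<noteq> n - 2"
    then show ?thesis using p(2) t_low[of k q] r_mem(3)[of k] by (simp add: e_def)
  qed
  have t_r: "t (r j) k = (if k = n - 2 then b $ (r j) else if k = j then 1 else 0)"
    if j: "j < n - 2" and k: "k < n" for j k
    using rows[OF k]
  proof (elim disjE conjE)
    assume k': "k = n - 1"
    have "n - 1 \<noteq> j" using j by arith
    with k' ne t_last[of "r j"] r_mem(2)[OF j] show ?thesis by (simp add: e_def)
  next
    assume "k = n - 2"
    then show ?thesis using t_pen[of "r j"] r_mem(2)[OF j] by (simp add: e_def)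
  next
    assume "k < n - 2" "k \<noteq> n - 2"
    then show ?thesis using t_low[of k "r j"] r_mem(2)[OF j] r_inj[OF j, of k]
      by (auto simp: e_def)
  qed
  have "Tinv * T = 1\<^sub>m n"
  proof (rule eq_matI)
    fix j k assume "j < dim_row (1\<^sub>m n :: 'k mat)" "k < dim_col (1\<^sub>m n :: 'k mat)"
    then have j: "j < n" and k: "k < n" by auto
    have "(Tinv * T) $$ (j, k) = (\<Sum>i<n. w j i * t i k)"
      using j k by (simp add: T_def Tinv_def scalar_prod_def atLeast0LessThan)
    also have "\<dots> = (if j = k then 1 else 0)"
    proof -
      consider "j = n - 1" | "j \<noteq> n - 1" "j = n - 2" | "j < n - 2" "j \<noteq> n - 1" "j \<noteq> n - 2"
        using rows[OF j] by blast
      then show ?thesis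
      proof cases
        case 1
        with w_act[OF j, of "\<lambda>i. t i k"] sum_t[OF k] show ?thesis by auto
      next
        case 2
        with w_act[OF j, of "\<lambda>i. t i k"] t_q[OF k] q(2) show ?thesis by auto
      next
        case 3
        with w_act[OF j, of "\<lambda>i. t i k"] t_q[OF k] t_r[OF 3(1) k] q(2) show ?thesis by auto
      qed
    qed
    finally show "(Tinv * T) $$ (j, k) = 1\<^sub>m n $$ (j, k)" using j k by simp
  qed (simp_all add: T_def Tinv_def)
  then have inv: "Tinv * T = 1\<^sub>m n" "T * Tinv = 1\<^sub>m n"
    using mat_mult_left_right_inverse[OF Tinv T] by auto
  have "Tinv * system_mat b = canonical_mat b * Tinv"
  proof (rule eq_matI)
    fix j k
    assume "j < dim_row (canonical_mat b * Tinv)" "k < dim_col (canonical_mat b * Tinv)"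
    then have j: "j < n" and k: "k < n" by (auto simp: canonical_mat_def Tinv_def db)
    have "(Tinv * system_mat b) $$ (j, k) = (\<Sum>i<n. w j i * b $ i)"
      using j k by (simp add: system_mat_def Tinv_def scalar_prod_def atLeast0LessThan db)
    also have "\<dots> = (if j = n - 1 then s else if j = n - 2 then 1 else 0)"
      using w_act[OF j, of "\<lambda>i. b $ i"] q(2) s by auto
    \<comment> \<open>Only the last column of the canonical form is nonzero, so its product with \<open>Tinv\<close>
        sees only the last row of \<open>Tinv\<close>, which is constantly one.\<close>
    also have "\<dots> = (\<Sum>i<n. e (n - 1) i *
        ((if j = n - 2 then 1 else if j = n - 1 then s else 0) * w i k))"
      using n ne pick[of "n - 1" "\<lambda>i. (if j = n - 2 then 1 else if j = n - 1 then s else 0) * w i k"]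
      by (auto simp: w_def)
    also have "\<dots> = (\<Sum>i<n. (if j = n - 2 \<and> i = n - 1 then 1
        else if j = n - 1 \<and> i = n - 1 then s else 0) * w i k)"
      by (intro sum.cong) (auto simp: e_def)
    also have "\<dots> = (canonical_mat b * Tinv) $$ (j, k)"
      using j k unfolding canonical_mat_def Tinv_def db s_def
      by (simp add: scalar_prod_def atLeast0LessThan)
    finally show "(Tinv * system_mat b) $$ (j, k) = (canonical_mat b * Tinv) $$ (j, k)" .
  qed (simp_all add: canonical_mat_def system_mat_def Tinv_def db)
  then have "Tinv * system_mat b * T = canonical_mat b"
    using assoc_mult_mat[OF canonical_mat_carrier[OF b] Tinv T] inv(1)
      canonical_mat_carrier[OF b] by simp
  with T Tinv inv show ?thesis
    by (intro exI[of _ T] exI[of _ Tinv]) (auto simp: inverts_mat_def)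
qed

section \<open>Scalar matrices acting on columns of vectors\<close>

lemma mat_act_mult:
  assumes "vector_space scale"
    and "M \<in> carrier_mat m k" and "N \<in> carrier_mat k l"
  shows "mat_act scale (M * N) x = mat_act scale M (mat_act scale N x)"
proof -
  interpret vector_space scale by fact
  show ?thesis
  proof (rule eq_vecI)
    fix i assume "i < dim_vec (mat_act scale M (mat_act scale N x))"
    then have i: "i < m" using assms by (simp add: mat_act_def)
    have "mat_act scale (M * N) x $ i
        = (\<Sum>j<l. \<Sum>h<k. scale (M $$ (i, h)) (scale (N $$ (h, j)) (x $ j)))"
      using i assms(2,3)
      by (simp add: mat_act_def scalar_prod_def atLeast0LessThan scale_sum_left)
    also have "\<dots> = (\<Sum>h<k. \<Sum>j<l. scale (M $$ (i, h)) (scale (N $$ (h, j)) (x $ j)))"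
      by (rule sum.swap)
    also have "\<dots> = mat_act scale M (mat_act scale N x) $ i"
      using i assms(2,3) by (simp add: mat_act_def scale_sum_right)
    finally show "mat_act scale (M * N) x $ i = mat_act scale M (mat_act scale N x) $ i" .
  qed (simp add: mat_act_def)
qed

lemma mat_act_add:
  assumes "vector_space scale" and "M \<in> carrier_mat m n" and "i < m"
    and "y \<in> carrier_vec n"
  shows "mat_act scale M (x + y) $ i = mat_act scale M x $ i + mat_act scale M y $ i"
proof -
  interpret vector_space scale by fact
  show ?thesis using assms(2-4) by (simp add: mat_act_def scale_right_distrib sum.distrib)
qed

lemma linear_mat_act:
  assumes "Vector_Spaces.linear scale scale A"
    and "M \<in> carrier_mat m n" and "x \<in> carrier_vec n" and "i < m"
  shows "A (mat_act scale M x $ i) = mat_act scale M (map_vec A x) $ i"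
proof -
  interpret Vector_Spaces.linear scale scale A by fact
  show ?thesis using assms(2-4) by (simp add: mat_act_def sum scale)
qed

text \<open>
  Since $T$ has the inverse $S$, the relation $C = S B T$ amounts to $C S = S B$. In this form it
  moves $S$ past $B$ without reconstructing $x$ from $S x$.
\<close>

lemma mat_act_similar_system:
  assumes vs: "vector_space scale" and lin: "Vector_Spaces.linear scale scale A"
    and B: "B \<in> carrier_mat n n" and T: "T \<in> carrier_mat n n" and S: "S \<in> carrier_mat n n"
    and TS: "inverts_mat T S" and C: "C = S * B * T"
    and x: "x \<in> carrier_vec n" and \<phi>: "\<phi> \<in> carrier_vec n"
    and eq: "map_vec A x = mat_act scale B x + \<phi>"
    and i: "i < n"
  shows "A (mat_act scale S x $ i) = mat_act scale C (mat_act scale S x) $ i + mat_act scale S \<phi> $ i"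
proof -
  have "T * S = 1\<^sub>m n" using TS T by (simp add: inverts_mat_def)
  then have SB: "C * S = S * B"
    unfolding C using assoc_mult_mat[OF mult_carrier_mat[OF S B] T S] S B by simp
  have CC: "C \<in> carrier_mat n n" unfolding C using S B T by simp
  have "A (mat_act scale S x $ i) = mat_act scale S (mat_act scale B x + \<phi>) $ i"
    using linear_mat_act[OF lin S x i] eq by simp
  also have "\<dots> = mat_act scale S (mat_act scale B x) $ i + mat_act scale S \<phi> $ i"
    by (rule mat_act_add[OF vs S i \<phi>])
  also have "mat_act scale S (mat_act scale B x) = mat_act scale C (mat_act scale S x)"
    using mat_act_mult[OF vs S B] mat_act_mult[OF vs CC S] SB by metis
  finally show ?thesis .
qed

section \<open>Transforming the system\<close>

lemma solves_system_iff_mat_act: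
  assumes "b \<in> carrier_vec n" and "x \<in> carrier_vec n" and "\<phi> \<in> carrier_vec n"
  shows "solves_system scale A b \<phi> x \<longleftrightarrow> map_vec A x = mat_act scale (system_mat b) x + \<phi>"
  using assms by (auto simp: solves_system_def mat_act_def system_mat_def vec_eq_iff)

lemma mat_act_canonical_mat:
  assumes vs: "vector_space scale" and n: "n \<ge> 2" and b: "b \<in> carrier_vec n" and i: "i < n"
  shows "mat_act scale (canonical_mat b) z $ i =
    (if i = n - 2 then z $ (n - 1) else if i = n - 1 then scale (coeff_sum b) (z $ (n - 1)) else 0)"
proof -
  interpret vector_space scale by fact
  have "n - 2 \<noteq> n - 1" using n by simp
  have "mat_act scale (canonical_mat b) z $ i = (\<Sum>k<n. scale (canonical_mat b $$ (i, k)) (z $ k))"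
    using i b by (simp add: mat_act_def canonical_mat_def)
  also have "\<dots> = (\<Sum>k<n. if k = n - 1 then
      (if i = n - 2 then z $ (n - 1) else if i = n - 1 then scale (coeff_sum b) (z $ (n - 1)) else 0)
      else 0)"
    by (intro sum.cong refl) (use i b \<open>n - 2 \<noteq> n - 1\<close> in \<open>auto simp: canonical_mat_def\<close>)
  finally show ?thesis using n by simp
qed

text \<open>
  The last two equations of the first-order system form a chain, and the second-order equation
  results from applying $A - s$ to the one for $A(z_{n-1})$. The converse fails in general: the
  second-order system determines $A(z_{n-1}) - z_n - \nu_{n-1}$ only up to the kernel of $A - s$.
\<close>

lemma solves_reduced_systemI:
  assumes vs: "vector_space scale" and lin: "Vector_Spaces.linear scale scale A"
    and n: "n \<ge> 2" and b: "b \<in> carrier_vec n"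
    and eq: "\<And>i. i < n \<Longrightarrow> A (z $ i) = mat_act scale (canonical_mat b) z $ i + \<nu> $ i"
  shows "solves_reduced_system scale A b \<nu> z"
proof -
  interpret vector_space scale by fact
  interpret A: Vector_Spaces.linear scale scale A by fact
  define s where "s = coeff_sum b"
  note act = mat_act_canonical_mat[OF vs n b, of _ z]
  have low: "A (z $ j) = \<nu> $ j" if "j < n - 2" for j
  proof -
    have "j < n" "j \<noteq> n - 2" "j \<noteq> n - 1" using that by auto
    with eq[of j] act[of j] show ?thesis by simp
  qed
  have mid: "A (z $ (n - 2)) = z $ (n - 1) + \<nu> $ (n - 2)"
    using eq[of "n - 2"] act[of "n - 2"] n by simp
  have top: "A (z $ (n - 1)) = scale s (z $ (n - 1)) + \<nu> $ (n - 1)"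
  proof -
    have "n - 1 < n" "n - 1 \<noteq> n - 2" using n by auto
    with eq[of "n - 1"] act[of "n - 1"] show ?thesis by (simp add: s_def)
  qed
  have "A (A (z $ (n - 2))) - scale s (A (z $ (n - 2)))
      = \<nu> $ (n - 1) + A (\<nu> $ (n - 2)) - scale s (\<nu> $ (n - 2))"
    unfolding mid A.add top scale_right_distrib by simp
  with low top b show ?thesis
    by (simp add: solves_reduced_system_def Let_def s_def)
qed

theorem theorem4p2:
  fixes scale :: "'k::field \<Rightarrow> 'v::ab_group_add \<Rightarrow> 'v"
    and A :: "'v \<Rightarrow> 'v"
    and b :: "'k vec"
    and \<phi> :: "'v vec"
    and n :: nat
  assumes "vector_space scale"
    and "Vector_Spaces.linear scale scale A"
    and "n \<ge> 2"
    and "b \<in> carrier_vec n"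
    and "\<phi> \<in> carrier_vec n"
  shows "(system_mat b \<noteq> 0\<^sub>m n n \<longrightarrow>
            (\<exists>T Tinv. T \<in> carrier_mat n n \<and> Tinv \<in> carrier_mat n n \<and>
               inverts_mat T Tinv \<and> inverts_mat Tinv T \<and>
               canonical_mat b = Tinv * system_mat b * T)) \<and>
         (\<forall>T Tinv. T \<in> carrier_mat n n \<and> Tinv \<in> carrier_mat n n \<and>
               inverts_mat T Tinv \<and> inverts_mat Tinv T \<and>
               canonical_mat b = Tinv * system_mat b * T \<longrightarrow>
            (\<forall>x \<in> carrier_vec n. solves_system scale A b \<phi> x \<longrightarrow>
               solves_reduced_system scale A b (mat_act scale Tinv \<phi>) (mat_act scale Tinv x)))"
proof (intro conjI impI allI ballI)
  assume "system_mat b \<noteq> 0\<^sub>m n n"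
  then show "\<exists>T Tinv. T \<in> carrier_mat n n \<and> Tinv \<in> carrier_mat n n \<and>
      inverts_mat T Tinv \<and> inverts_mat Tinv T \<and> canonical_mat b = Tinv * system_mat b * T"
    by (rule system_mat_similar_canonical_mat[OF assms(3,4)])
next
  fix T Tinv x
  assume T: "T \<in> carrier_mat n n \<and> Tinv \<in> carrier_mat n n \<and>
      inverts_mat T Tinv \<and> inverts_mat Tinv T \<and> canonical_mat b = Tinv * system_mat b * T"
    and x: "x \<in> carrier_vec n" and sol: "solves_system scale A b \<phi> x"
  have "map_vec A x = mat_act scale (system_mat b) x + \<phi>"
    using sol solves_system_iff_mat_act[OF assms(4) x assms(5)] by blast
  with T show "solves_reduced_system scale A b (mat_act scale Tinv \<phi>) (mat_act scale Tinv x)"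
    by (intro solves_reduced_systemI[OF assms(1-4)]
        mat_act_similar_system[OF assms(1,2) system_mat_carrier[OF assms(4)] _ _ _ _ x assms(5)])
      auto
qed

end
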